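(* Let $n\ge 3f+1$. On every delivered view $V(r)$, the protocol $\textsc{H-CSC}^{\det}$ commits if and only if the protocol $\textsc{M3}^{\det}$ commits, and when they commit both commit the same verdict $v^\star$. Hence, over any collection of tasks (delivered views), their commit rates, their honest-reference invalid-commit rates, and their per-task commit sets are identical.
   Context: There are $n$ agents $\mathcal{N}=\{1,\dots,n\}$ and a fault bound $f\ge0$ (integers); a set $\mathcal{B}\subseteq\mathcal{N}$ of at most $f$ agents is Byzantine and $\mathcal{H}=\mathcal{N}\setminus\mathcal{B}$ is honest. A delivered view $V(r)$ consists of an index set $I_r\subseteq\mathcal{N}$ with $|I_r|\ge n-f$ and, for each $i\in I_r$, a verdict in $\{\textsc{support},\textsc{refute},\textsc{insufficient}\}$ and a unit vector (embedding) $\mathbf{e}_i\in\mathbb{S}^{d-1}$. $G_v$ is the set of delivered agents with verdict $v$; $v^\star=\arg\max_v|G_v|$ with ties broken by $\textsc{support}>\textsc{refute}>\textsc{insufficient}$; $\textit{verdict\_margin}=|G_{v^\star}|-\max_{v\ne v^\star}|G_v|$. The selected core $\widehat{C}\subseteq G_{v^\star}$ is the largest connected component (deterministic tie-break) of the graph on $G_{v^\star}$ joining $i,j$ when $\angle(\mathbf{e}_i,\mathbf{e}_j)\le\theta_\alpha$, for a fixed radius $\theta_\alpha>0$. The core is admissible if $|\widehat{C}|\ge 2f+1$ and some $h\in\widehat{C}$ satisfies $\angle(\mathbf{e}_h,\mathbf{e}_j)\le\theta_\alpha$ for all $j\in\widehat{C}$. $\textsc{M3}^{\det}$ (certificate-wrapped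 majority at the deterministic operating point) commits the verdict $v^\star$ if and only if its gate holds: $|G_{v^\star}|\ge 2f+1$ and $\textit{verdict\_margin}>f$. $\textsc{H-CSC}^{\det}$ first evaluates the semantic gate: $\widehat{C}$ is admissible and $|\widehat{C}|>(n+f)/2$; if it holds, it commits $v^\star$ on the semantic branch. Otherwise it evaluates the verdict gate: $|G_{v^\star}|\ge 2f+1$ and $\textit{verdict\_margin}>f$; if it holds, it commits $v^\star$ on the verdict branch. Otherwise it aborts. (Commitment is considered at the level of these decision predicates.) The commit rate is the fraction of views on which the protocol commits. The honest-reference verdict $\mathrm{majority}_{\mathcal{H}}(V)$ is the verdict $v$ maximising $|G_v\cap\mathcal{H}|$, ties broken by the same priority order; a commit is honest-reference invalid if its verdict differs from it, and the honest-reference invalid-commit rate is the fraction of views with such a commit. *)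

theory Defs
  imports "HOL-Analysis.Analysis"
begin

datatype verdict = Support | Refute | Insufficient

(* verdict_of and embedding_of are total functions; their values outside the index set are
   meaningless and are never inspected below. *)
record ('d::finite) view =
  index_set :: "nat set"
  verdict_of :: "nat \<Rightarrow> verdict"
  embedding_of :: "nat \<Rightarrow> real ^ 'd"

definition agents :: "nat \<Rightarrow> nat set" where
  "agents n = {1..n}"

definition delivered_view :: "nat \<Rightarrow> nat \<Rightarrow> 'd::finite view \<Rightarrow> bool" where
  "delivered_view n f V \<longleftrightarrow>
     index_set V \<subseteq> agents n \<and>
     int (card (index_set V)) \<ge> int n - int f \<and>
     (\<forall>i\<in>index_set V. norm (embedding_of V i) = 1)"

definition verdict_group :: "'d::finite view \<Rightarrow> verdict \<Rightarrow> nat set" where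
  "verdict_group V v = {i \<in> index_set V. verdict_of V i = v}"

(* The list order is the tie-breaking priority: the first maximiser in the list is taken. *)
definition argmax_verdict :: "(verdict \<Rightarrow> nat) \<Rightarrow> verdict" where
  "argmax_verdict c = hd (filter (\<lambda>v. \<forall>w. c w \<le> c v) [Support, Refute, Insufficient])"

definition top_verdict :: "'d::finite view \<Rightarrow> verdict" where
  "top_verdict V = argmax_verdict (\<lambda>v. card (verdict_group V v))"

definition verdict_margin :: "'d::finite view \<Rightarrow> int" where
  "verdict_margin V =
     int (card (verdict_group V (top_verdict V))) -
     int (Max {card (verdict_group V v) | v. v \<noteq> top_verdict V})"

definition vec_angle :: "real ^ 'd \<Rightarrow> real ^ 'd \<Rightarrow> real" where
  "vec_angle x y = arccos ((x \<bullet> y) / (norm x * norm y))"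

definition core_edges :: "real \<Rightarrow> 'd::finite view \<Rightarrow> (nat \<times> nat) set" where
  "core_edges \<theta> V =
     {(i, j). i \<in> verdict_group V (top_verdict V) \<and> j \<in> verdict_group V (top_verdict V) \<and>
              vec_angle (embedding_of V i) (embedding_of V j) \<le> \<theta>}"

definition core_components :: "real \<Rightarrow> 'd::finite view \<Rightarrow> nat set set" where
  "core_components \<theta> V = {(core_edges \<theta> V)\<^sup>* `` {i} | i. i \<in> verdict_group V (top_verdict V)}"

(* The deterministic tie-break between largest components is left unspecified: a core selection
   is any function of the view whose value is a largest connected component. *)
definition core_selection ::
    "nat \<Rightarrow> nat \<Rightarrow> real \<Rightarrow> ('d::finite view \<Rightarrow> nat set) \<Rightarrow> bool" where
  "core_selection n f \<theta> core \<longleftrightarrow>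
     (\<forall>V. delivered_view n f V \<longrightarrow>
        core V \<in> core_components \<theta> V \<and>
        (\<forall>C\<in>core_components \<theta> V. card C \<le> card (core V)))"

definition admissible :: "nat \<Rightarrow> real \<Rightarrow> 'd::finite view \<Rightarrow> nat set \<Rightarrow> bool" where
  "admissible f \<theta> V C \<longleftrightarrow>
     card C \<ge> 2 * f + 1 \<and>
     (\<exists>h\<in>C. \<forall>j\<in>C. vec_angle (embedding_of V h) (embedding_of V j) \<le> \<theta>)"

definition verdict_gate :: "nat \<Rightarrow> 'd::finite view \<Rightarrow> bool" where
  "verdict_gate f V \<longleftrightarrow>
     card (verdict_group V (top_verdict V)) \<ge> 2 * f + 1 \<and> verdict_margin V > int f"

definition semantic_gate ::
    "nat \<Rightarrow> nat \<Rightarrow> real \<Rightarrow> ('d::finite view \<Rightarrow> nat set) \<Rightarrow> 'd view \<Rightarrow> bool" where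
  "semantic_gate n f \<theta> core V \<longleftrightarrow>
     admissible f \<theta> V (core V) \<and> real (card (core V)) > (real n + real f) / 2"

datatype branch = Semantic_Branch | Verdict_Branch

(* Protocol outcomes: None is an abort, Some v is a commit of v. *)

definition m3_det :: "nat \<Rightarrow> 'd::finite view \<Rightarrow> verdict option" where
  "m3_det f V = (if verdict_gate f V then Some (top_verdict V) else None)"

definition hcsc_det_run ::
    "nat \<Rightarrow> nat \<Rightarrow> real \<Rightarrow> ('d::finite view \<Rightarrow> nat set) \<Rightarrow> 'd view \<Rightarrow> (branch \<times> verdict) option" where
  "hcsc_det_run n f \<theta> core V =
     (if semantic_gate n f \<theta> core V then Some (Semantic_Branch, top_verdict V)
      else if verdict_gate f V then Some (Verdict_Branch, top_verdict V)
      else None)"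

definition hcsc_det ::
    "nat \<Rightarrow> nat \<Rightarrow> real \<Rightarrow> ('d::finite view \<Rightarrow> nat set) \<Rightarrow> 'd view \<Rightarrow> verdict option" where
  "hcsc_det n f \<theta> core V = map_option snd (hcsc_det_run n f \<theta> core V)"

definition commits :: "('d::finite view \<Rightarrow> verdict option) \<Rightarrow> 'd view \<Rightarrow> bool" where
  "commits P V \<longleftrightarrow> P V \<noteq> None"

definition honest_majority :: "nat set \<Rightarrow> 'd::finite view \<Rightarrow> verdict" where
  "honest_majority H V = argmax_verdict (\<lambda>v. card (verdict_group V v \<inter> H))"

definition invalid_commit :: "nat set \<Rightarrow> ('d::finite view \<Rightarrow> verdict option) \<Rightarrow> 'd view \<Rightarrow> bool" where
  "invalid_commit H P V \<longleftrightarrow> (\<exists>v. P V = Some v \<and> v \<noteq> honest_majority H V)"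

(* A collection of tasks is a set T with a view W t for every task t in T, so that distinct
   tasks may have equal views. *)

definition commit_set :: "('d::finite view \<Rightarrow> verdict option) \<Rightarrow> 't set \<Rightarrow> ('t \<Rightarrow> 'd view) \<Rightarrow> 't set" where
  "commit_set P T W = {t \<in> T. commits P (W t)}"

definition commit_rate :: "('d::finite view \<Rightarrow> verdict option) \<Rightarrow> 't set \<Rightarrow> ('t \<Rightarrow> 'd view) \<Rightarrow> real" where
  "commit_rate P T W = real (card {t \<in> T. commits P (W t)}) / real (card T)"

definition invalid_commit_rate ::
    "nat set \<Rightarrow> ('d::finite view \<Rightarrow> verdict option) \<Rightarrow> 't set \<Rightarrow> ('t \<Rightarrow> 'd view) \<Rightarrow> real" where
  "invalid_commit_rate H P T W =
     real (card {t \<in> T. invalid_commit H P (W t)}) / real (card T)"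

end

theory Submission
  imports Defs
begin

text \<open>
  The semantic gate implies the verdict gate: a core of more than \<open>(n + f) / 2\<close> agents sits inside
  the top verdict group, so all other groups together have fewer than \<open>(n - f) / 2\<close> delivered
  agents and the margin exceeds \<open>f\<close>. Hence the semantic branch never adds a commit, and both
  branches commit the same verdict.
\<close>

text \<open>Both endpoints of every edge in \<open>core_edges\<close> lie in the top group, so a
  path starting there never leaves it.\<close>

lemma core_component_subset:
  assumes "C \<in> core_components \<theta> V"
  shows "C \<subseteq> verdict_group V (top_verdict V)"
proof -
  obtain i where i: "i \<in> verdict_group V (top_verdict V)" and C: "C = (core_edges \<theta> V)\<^sup>* `` {i}"
    using assms by (auto simp: core_components_def)
  have "j \<in> verdict_group V (top_verdict V)" if "(i, j) \<in> (core_edges \<theta> V)\<^sup>*" for j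
    using that i by induction (auto simp: core_edges_def)
  then show ?thesis
    using C by auto
qed

lemma delivered_view_finite: "delivered_view n f V \<Longrightarrow> finite (index_set V)"
  by (auto simp: delivered_view_def agents_def intro: finite_subset)

text \<open>Each agent gives a single verdict, so distinct groups are disjoint subsets of the
  \<open>n\<close> agents.\<close>

lemma card_verdict_groups_le:
  assumes V: "delivered_view n f V" and "v \<noteq> w"
  shows "card (verdict_group V v) + card (verdict_group V w) \<le> n"
proof -
  have fin: "finite (verdict_group V u)" for u
    using delivered_view_finite[OF V] by (simp add: verdict_group_def)
  have "verdict_group V v \<inter> verdict_group V w = {}"
    using \<open>v \<noteq> w\<close> by (auto simp: verdict_group_def)
  then have "card (verdict_group V v) + card (verdict_group V w)
      = card (verdict_group V v \<union> verdict_group V w)"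
    by (simp add: card_Un_disjoint fin)
  also have "\<dots> \<le> card (agents n)"
    using V by (intro card_mono) (auto simp: verdict_group_def delivered_view_def agents_def)
  finally show ?thesis
    by (simp add: agents_def)
qed

text \<open>The runner-up group is disjoint from the top group, hence has at most \<open>n\<close>
  minus the top group's size many members.\<close>

lemma verdict_margin_ge:
  assumes V: "delivered_view n f V"
  shows "verdict_margin V \<ge> 2 * int (card (verdict_group V (top_verdict V))) - int n"
proof -
  let ?S = "{card (verdict_group V v) | v. v \<noteq> top_verdict V}"
  have "UNIV = {Support, Refute, Insufficient}"
    using verdict.exhaust by blast
  then have "finite (UNIV :: verdict set)"
    by (metis finite.emptyI finite.insertI)
  then have "finite ?S"
    by (auto intro: finite_subset simp: setcompr_eq_image)
  \<comment> \<open>\<open>Support\<close> and \<open>Refute\<close> differ, so at least one of them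
    is not the top verdict.\<close>
  moreover have "?S \<noteq> {}"
    by (metis (mono_tags, lifting) empty_iff mem_Collect_eq verdict.distinct(1))
  \<comment> \<open>The maximum is attained, which yields a concrete runner-up verdict to compare
    with the top one.\<close>
  ultimately have "Max ?S \<in> ?S"
    by (rule Max_in)
  then obtain v where "v \<noteq> top_verdict V" and "Max ?S = card (verdict_group V v)"
    by blast
  with card_verdict_groups_le[OF V this(1)] show ?thesis
    unfolding verdict_margin_def by linarith
qed

lemma semantic_gate_imp_verdict_gate:
  assumes V: "delivered_view n f V" and core: "core_selection n f \<theta> core"
    and gate: "semantic_gate n f \<theta> core V"
  shows "verdict_gate f V"
proof -
  have "core V \<subseteq> verdict_group V (top_verdict V)"
    using V core by (intro core_component_subset[of _ \<theta>]) (simp add: core_selection_def)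
  then have "card (core V) \<le> card (verdict_group V (top_verdict V))"
    using delivered_view_finite[OF V] by (intro card_mono) (auto simp: verdict_group_def)
  \<comment> \<open>Admissibility supplies the size bound; the real threshold, doubled, becomes an
    inequality of naturals without rounding.\<close>
  moreover have "2 * f + 1 \<le> card (core V)" and "n + f < 2 * card (core V)"
    using gate by (auto simp: semantic_gate_def admissible_def)
  \<comment> \<open>With top group G and core C, the margin is at least 2|G| - n \<ge> 2|C| - n >
    f.\<close>
  ultimately show ?thesis
    using verdict_margin_ge[OF V] unfolding verdict_gate_def by linarith
qed

text \<open>If the semantic gate holds, so does the verdict gate and both protocols commit the top
  verdict; otherwise \<open>hcsc_det\<close> falls back on the very test of
  \<open>m3_det\<close>.\<close>

lemma hcsc_det_eq_m3_det:
  assumes "delivered_view n f V" and "core_selection n f \<theta> core"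
  shows "hcsc_det n f \<theta> core V = m3_det f V"
  using semantic_gate_imp_verdict_gate[OF assms]
  by (simp add: hcsc_det_def hcsc_det_run_def m3_det_def)

theorem corollary5p1:
  fixes n f :: nat
    and B H :: "nat set"
    and \<theta> :: real
    and core :: "'d::finite view \<Rightarrow> nat set"
  assumes "n \<ge> 3 * f + 1"
    and "B \<subseteq> agents n" and "card B \<le> f" and "H = agents n - B"
    and "\<theta> > 0"
    and "core_selection n f \<theta> core"
  shows
    "(\<forall>V. delivered_view n f V \<longrightarrow>
        (commits (hcsc_det n f \<theta> core) V \<longleftrightarrow> commits (m3_det f) V) \<and>
        (commits (hcsc_det n f \<theta> core) V \<and> commits (m3_det f) V \<longrightarrow>
           hcsc_det n f \<theta> core V = Some (top_verdict V) \<and>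
           m3_det f V = Some (top_verdict V))) \<and>
     (\<forall>(T :: 't set) (W :: 't \<Rightarrow> 'd view).
        (\<forall>t\<in>T. delivered_view n f (W t)) \<longrightarrow>
        commit_set (hcsc_det n f \<theta> core) T W = commit_set (m3_det f) T W \<and>
        (finite T \<longrightarrow>
           commit_rate (hcsc_det n f \<theta> core) T W = commit_rate (m3_det f) T W \<and>
           invalid_commit_rate H (hcsc_det n f \<theta> core) T W =
             invalid_commit_rate H (m3_det f) T W))"
proof -
  let ?P = "hcsc_det n f \<theta> core" and ?Q = "m3_det f"
  have eq: "?P V = ?Q V" if "delivered_view n f V" for V
    using that assms(6) by (rule hcsc_det_eq_m3_det)
  have top: "?Q V = Some (top_verdict V)" if "commits ?Q V" for V :: "'d view"
    using that by (simp add: commits_def m3_det_def split: if_splits)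
  have "commit_set ?P T W = commit_set ?Q T W \<and>
      commit_rate ?P T W = commit_rate ?Q T W \<and>
      invalid_commit_rate H ?P T W = invalid_commit_rate H ?Q T W"
    if "\<forall>t\<in>T. delivered_view n f (W t)" for T :: "'t set" and W :: "'t \<Rightarrow> 'd view"
  proof -
    have "?P (W t) = ?Q (W t)" if "t \<in> T" for t
      using that \<open>\<forall>t\<in>T. delivered_view n f (W t)\<close> eq by blast
    \<comment> \<open>Committing and invalidity depend on a protocol only through its outcome on the
      view, so equal outcomes give equal task sets and hence equal rates.\<close>
    then have "{t \<in> T. commits ?P (W t)} = {t \<in> T. commits ?Q (W t)}"
      and "{t \<in> T. invalid_commit H ?P (W t)} = {t \<in> T. invalid_commit H ?Q (W t)}"
      by (auto simp: commits_def invalid_commit_def)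
    then show ?thesis
      by (simp add: commit_set_def commit_rate_def invalid_commit_rate_def)
  qed
  moreover have "commits ?P V \<longleftrightarrow> commits ?Q V" if "delivered_view n f V" for V
    using eq[OF that] by (simp add: commits_def)
  ultimately show ?thesis
    using eq top by simp
qed

end
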